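(* Let $n_1,n_2,n_3$ be positive integers, let $1 \le q \le n_1$, and let $p = \lfloor q \cdot \frac{n_3}{n_2+n_3}\rfloor$. Let $T = \sum_{\ell=1}^r a^{(\ell)}\otimes b^{(\ell)}\otimes c^{(\ell)} \in \mathbb{R}^{n_1\times n_2\times n_3}$ with $a^{(\ell)}\in\mathbb{R}^{n_1}$, $b^{(\ell)}\in\mathbb{R}^{n_2}$, $c^{(\ell)}\in\mathbb{R}^{n_3}$ generically chosen. If $$ r \le (n_2+n_3)\left(1-\frac{1+\alpha}{q}\right) - q, \qquad \alpha := \max\left\{\frac{n_2}{n_3},\frac{n_3}{n_2}\right\},$$ then the matrix $M(T;p,q)$ has rank exactly $r\binom{q-1}{p}$.
   Context: For a tensor $T \in \mathbb{R}^{n_1\times n_2\times n_3}$ with entries $T_{ijk}$ and integers $0\le p<q\le n_1$, the matrix $M(T;p,q)$ has rows indexed by pairs $(S,j)$ with $S \subseteq [q]$, $|S|=p$, $j\in[n_2]$, columns indexed by pairs $(U,k)$ with $U\subseteq[q]$, $|U|=p+1$, $k\in[n_3]$, and entries $M_{Sj,Uk} = \sum_{i=1}^q \mathbf{1}_{U = S\sqcup\{i\}}\,\sigma(U,i)\,T_{ijk}$, where $\sigma(U,i) := (-1)^{|\{j\in U : j<i\}|}$. "Generically chosen components" means: there is a nonidentically-zero polynomial in all the coordinates of all the vectors $a^{(\ell)},b^{(\ell)},c^{(\ell)}$ such that the statement holds whenever this polynomial is nonzero. *)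

theory Defs
  imports
    Complex_Main
    "HOL-Library.Poly_Mapping"
    "Jordan_Normal_Form.DL_Rank"
begin

text \<open>
  Tensors, vectors and subsets are indexed from 1, as in [n] = {1, ..., n}. An element of
  the space of n1 x n2 x n3 tensors is a function of which only the values at indices in
  [n1], [n2], [n3] matter; likewise for vectors.
\<close>

type_synonym tensor3 = "nat \<Rightarrow> nat \<Rightarrow> nat \<Rightarrow> real"

definition outer3 :: "(nat \<Rightarrow> real) \<Rightarrow> (nat \<Rightarrow> real) \<Rightarrow> (nat \<Rightarrow> real) \<Rightarrow> tensor3" where
  "outer3 u v w = (\<lambda>i j k. u i * v j * w k)"

definition tensor_of_components ::
  "nat \<Rightarrow> (nat \<Rightarrow> nat \<Rightarrow> real) \<Rightarrow> (nat \<Rightarrow> nat \<Rightarrow> real) \<Rightarrow> (nat \<Rightarrow> nat \<Rightarrow> real) \<Rightarrow> tensor3" where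
  "tensor_of_components r a b c = (\<lambda>i j k. \<Sum>l=1..r. outer3 (a l) (b l) (c l) i j k)"

definition sigma_sign :: "nat set \<Rightarrow> nat \<Rightarrow> real" where
  "sigma_sign U i = (- 1) ^ card {j \<in> U. j < i}"

definition M_entry :: "tensor3 \<Rightarrow> nat \<Rightarrow> nat set \<times> nat \<Rightarrow> nat set \<times> nat \<Rightarrow> real" where
  "M_entry T q = (\<lambda>(S, j) (U, k).
     \<Sum>i=1..q. (if i \<notin> S \<and> U = insert i S then sigma_sign U i * T i j k else 0))"

text \<open>
  The matrix library indexes rows and columns by initial segments of the naturals, so the
  index pairs (S, j), with S a subset of [q] of cardinality s and j in [n], are enumerated by
  a list without repetitions.
\<close>

definition subsets_list :: "nat \<Rightarrow> nat \<Rightarrow> nat set list" where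
  "subsets_list q s = map set (filter (\<lambda>xs. length xs = s) (subseqs [1..<Suc q]))"

definition index_list :: "nat \<Rightarrow> nat \<Rightarrow> nat \<Rightarrow> (nat set \<times> nat) list" where
  "index_list q s n = List.product (subsets_list q s) [1..<Suc n]"

lemma set_subsets_list: "set (subsets_list q s) = {S. S \<subseteq> {1..q} \<and> card S = s}"
proof -
  have dist: "distinct xs" if "xs \<in> set (subseqs [1..<Suc q])" for xs
    using subseqs_distinctD[OF that distinct_upt] .
  have pow: "set ` set (subseqs [1..<Suc q]) = Pow {1..q}"
    unfolding subseqs_powset set_upt atLeastLessThanSuc_atLeastAtMost ..
  have "set (subsets_list q s) = {S \<in> set ` set (subseqs [1..<Suc q]). card S = s}"
    unfolding subsets_list_def set_map set_filter using dist distinct_card by fastforce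
  then show ?thesis
    unfolding pow by simp
qed

lemma distinct_subsets_list: "distinct (subsets_list q s)"
proof -
  have "distinct (map set (subseqs [1..<Suc q]))"
    by (rule distinct_set_subseqs) simp
  then show ?thesis
    unfolding subsets_list_def by (simp add: distinct_map inj_on_def)
qed

lemma set_index_list:
  "set (index_list q s n) = {S. S \<subseteq> {1..q} \<and> card S = s} \<times> {1..n}"
  by (simp add: index_list_def set_subsets_list atLeastLessThanSuc_atLeastAtMost del: upt_Suc)

lemma distinct_index_list: "distinct (index_list q s n)"
  by (simp add: index_list_def distinct_product distinct_subsets_list del: upt_Suc)

text \<open>\<open>M_mat n2 n3 T p q\<close> is the matrix M(T;p,q) of an n1 x n2 x n3 tensor T, where q \<le> n1.\<close>

definition M_mat :: "nat \<Rightarrow> nat \<Rightarrow> tensor3 \<Rightarrow> nat \<Rightarrow> nat \<Rightarrow> real mat" where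
  "M_mat n2 n3 T p q =
     mat (length (index_list q p n2)) (length (index_list q (p + 1) n3))
       (\<lambda>(x, y). M_entry T q (index_list q p n2 ! x) (index_list q (p + 1) n3 ! y))"

definition mat_rank :: "real mat \<Rightarrow> nat" where
  "mat_rank A = vec_space.rank (dim_row A) A"

text \<open>
  Polynomials in indeterminates of type \<open>'v\<close> are finitely supported maps from monomials to
  coefficients, monomials being finitely supported maps from indeterminates to exponents.
\<close>

type_synonym 'v rpoly = "('v \<Rightarrow>\<^sub>0 nat) \<Rightarrow>\<^sub>0 real"

definition poly_vars :: "'v rpoly \<Rightarrow> 'v set" where
  "poly_vars P = (\<Union>m\<in>Poly_Mapping.keys P. Poly_Mapping.keys m)"

definition poly_eval :: "('v \<Rightarrow> real) \<Rightarrow> 'v rpoly \<Rightarrow> real" where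
  "poly_eval x P = (\<Sum>m\<in>Poly_Mapping.keys P.
     Poly_Mapping.lookup P m * (\<Prod>v\<in>Poly_Mapping.keys m. x v ^ Poly_Mapping.lookup m v))"

text \<open>\<open>ACoord l i\<close> is the indeterminate for the i-th coordinate of the l-th vector a, etc.\<close>

datatype coord = ACoord nat nat | BCoord nat nat | CCoord nat nat

definition coords :: "nat \<Rightarrow> nat \<Rightarrow> nat \<Rightarrow> nat \<Rightarrow> coord set" where
  "coords n1 n2 n3 r =
     {ACoord l i | l i. l \<in> {1..r} \<and> i \<in> {1..n1}} \<union>
     {BCoord l j | l j. l \<in> {1..r} \<and> j \<in> {1..n2}} \<union>
     {CCoord l k | l k. l \<in> {1..r} \<and> k \<in> {1..n3}}"

fun coord_val :: "(nat \<Rightarrow> nat \<Rightarrow> real) \<Rightarrow> (nat \<Rightarrow> nat \<Rightarrow> real) \<Rightarrow> (nat \<Rightarrow> nat \<Rightarrow> real) \<Rightarrow> coord \<Rightarrow> real"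
where
  "coord_val a b c (ACoord l i) = a l i"
| "coord_val a b c (BCoord l j) = b l j"
| "coord_val a b c (CCoord l k) = c l k"

definition for_generic_components ::
  "nat \<Rightarrow> nat \<Rightarrow> nat \<Rightarrow> nat \<Rightarrow>
   ((nat \<Rightarrow> nat \<Rightarrow> real) \<Rightarrow> (nat \<Rightarrow> nat \<Rightarrow> real) \<Rightarrow> (nat \<Rightarrow> nat \<Rightarrow> real) \<Rightarrow> bool) \<Rightarrow> bool" where
  "for_generic_components n1 n2 n3 r Q \<longleftrightarrow>
     (\<exists>P. poly_vars P \<subseteq> coords n1 n2 n3 r \<and>
          (\<exists>a b c. poly_eval (coord_val a b c) P \<noteq> 0) \<and>
          (\<forall>a b c. poly_eval (coord_val a b c) P \<noteq> 0 \<longrightarrow> Q a b c))"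

end

theory Submission
  imports Defs
begin

text \<open>
  Let \<open>K(x)\<close> be the matrix of the wedge product with \<open>x\<close>. Then \<open>M(T;p,q)\<close> is the sum over \<open>l\<close> of
  \<open>K(a\<^sub>l)\<close> tensored with the rank one matrix \<open>b\<^sub>l c\<^sub>l\<^sup>T\<close>. Since \<open>x \<and> (x \<and> w) = 0\<close>, the rows of \<open>K(x)\<close>
  indexed by the sets avoiding a fixed \<open>i\<close> with \<open>x i \<noteq> 0\<close> span all of its rows, and this gives the
  upper bound for all components. For the lower bound, let \<open>a\<^sub>l\<close> run cyclically through the standard
  basis of the \<open>q\<close>-dimensional space and take \<open>b\<^sub>l\<close>, \<open>c\<^sub>l\<close> on the moment curve. The flattening then
  factors through a space of dimension \<open>r * ((q - 1) choose p)\<close>, and by Lagrange interpolation both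
  factors have a one-sided inverse \<open>L\<close>, \<open>R\<close>, as at most \<open>n2\<close> of the \<open>b\<^sub>l\<close> belong to a common row set
  \<open>S\<close> and at most \<open>n3\<close> of the \<open>c\<^sub>l\<close> to a common column set \<open>U\<close>. With these fixed \<open>L\<close> and \<open>R\<close>,
  \<open>det (L * M * R)\<close> is a polynomial in the components that is not identically zero.
\<close>

section \<open>Rank bounds from matrix products\<close>

lemma (in vec_space) rank_mult_le:
  assumes A: "A \<in> carrier_mat n k" and B: "B \<in> carrier_mat k m"
  shows "rank (A * B) \<le> rank A"
proof -
  have AB: "A * B \<in> carrier_mat n m"
    using A B by simp
  have cA: "set (cols A) \<subseteq> carrier_vec n" and cAB: "set (cols (A * B)) \<subseteq> carrier_vec n"
    using A AB cols_dim by blast+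
  have "col_space (A * B) \<subseteq> col_space A"
  proof
    fix y assume "y \<in> col_space (A * B)"
    then obtain x where "x \<in> carrier_vec m" "y = (A * B) *\<^sub>v x"
      using B unfolding col_space_eq[OF AB] by auto
    then have "y = A *\<^sub>v (B *\<^sub>v x)" "B *\<^sub>v x \<in> carrier_vec k"
      using A B by (auto simp: assoc_mult_mat_vec)
    then show "y \<in> col_space A"
      using A unfolding col_space_eq[OF A] by auto
  qed
  then have sub: "span (set (cols (A * B))) \<subseteq> span (set (cols A))"
    unfolding col_space_def .
  have sA: "subspace class_ring (span (set (cols A))) V"
    and sAB: "subspace class_ring (span (set (cols (A * B)))) V"
    using cA cAB by (simp_all add: span_is_subspace)
  have "subspace class_ring (span (set (cols (A * B)))) (vs (span (set (cols A))))"
    by (rule nested_subspaces[OF sA sAB sub])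
  from vectorspace.subspace_dim[OF subspace_is_vs[OF sA] this fin_dim_span_cols[OF A]]
  show ?thesis
    using fin_dim_span_cols[OF AB] unfolding rank_def by simp
qed

lemma mat_rank_le_inner_dim:
  assumes "A \<in> carrier_mat n k" and "B \<in> carrier_mat k m"
  shows "mat_rank (A * B) \<le> k"
  using vec_space.rank_mult_le[OF assms] vec_space.rank_le_nc[OF assms(1)] assms
  by (simp add: mat_rank_def)

text \<open>Invertibility of \<open>C * A * B\<close> makes \<open>A * B\<close> injective on
  vectors, so its \<open>k\<close> columns are independent, and the rank of \<open>A * B\<close>
  cannot exceed that of \<open>A\<close>.\<close>

lemma mat_rank_ge_of_det_nonzero:
  assumes C: "C \<in> carrier_mat k n" and A: "A \<in> carrier_mat n m" and B: "B \<in> carrier_mat m k"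
    and det: "det (C * A * B) \<noteq> 0"
  shows "k \<le> mat_rank A"
proof -
  interpret vec_space "TYPE(real)" n .
  have AB: "A * B \<in> carrier_mat n k"
    using A B by simp
  have CAB: "C * (A * B) \<in> carrier_mat k k" and d: "det (C * (A * B)) \<noteq> 0"
    using A B C det by simp_all
  \<comment> \<open>Independence below concerns the set of columns, which hides repetitions. Equal
    columns of \<open>A * B\<close> would give equal columns of the invertible product.\<close>
  have dist: "distinct (cols (A * B))"
  proof (rule ccontr)
    assume "\<not> distinct (cols (A * B))"
    then obtain i j where ij: "i \<noteq> j" "i < k" "j < k" "col (A * B) i = col (A * B) j"
      using AB by (auto simp: distinct_conv_nth)
    then have "col (C * (A * B)) i = col (C * (A * B)) j"
      using C AB by simp
    then show False
      using det_identical_cols[OF CAB ij(1-3)] d by simp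
  qed
  have "lin_indpt (set (cols (A * B)))"
  proof
    assume "lin_dep (set (cols (A * B)))"
    then obtain v where v: "v \<in> carrier_vec k" "v \<noteq> 0\<^sub>v k" "(A * B) *\<^sub>v v = 0\<^sub>v n"
      using lin_depE[OF AB _ dist] by blast
    then have "(C * (A * B)) *\<^sub>v v = 0\<^sub>v k"
      using C AB by (auto simp: assoc_mult_mat_vec)
    then show False
      using v d det_0_iff_vec_prod_zero_field[OF CAB] by blast
  qed
  then have "rank (A * B) = k"
    using AB dist lin_indpt_full_rank by blast
  then show ?thesis
    using rank_mult_le[OF A B] A by (simp add: mat_rank_def)
qed

section \<open>Evaluation of polynomials, and polynomial functions\<close>

definition monom_eval :: "('v \<Rightarrow> real) \<Rightarrow> ('v \<Rightarrow>\<^sub>0 nat) \<Rightarrow> real" where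
  "monom_eval x m = (\<Prod>v\<in>Poly_Mapping.keys m. x v ^ Poly_Mapping.lookup m v)"

text \<open>Variables outside the support have exponent 0 and contribute the factor 1. This brings
  monomials with different supports onto one index set.\<close>

lemma monom_eval_superset:
  assumes "finite K" and "Poly_Mapping.keys m \<subseteq> K"
  shows "monom_eval x m = (\<Prod>v\<in>K. x v ^ Poly_Mapping.lookup m v)"
  unfolding monom_eval_def using assms
  by (intro prod.mono_neutral_left) (auto simp: in_keys_iff)

lemma monom_eval_add: "monom_eval x (m + m') = monom_eval x m * monom_eval x m'"
proof -
  let ?K = "Poly_Mapping.keys m \<union> Poly_Mapping.keys m'"
  have "monom_eval x (m + m') = (\<Prod>v\<in>?K. x v ^ Poly_Mapping.lookup (m + m') v)"
    by (rule monom_eval_superset) (simp_all add: keys_add)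
  also have "\<dots> = (\<Prod>v\<in>?K. x v ^ Poly_Mapping.lookup m v) * (\<Prod>v\<in>?K. x v ^ Poly_Mapping.lookup m' v)"
    by (simp add: lookup_add power_add prod.distrib)
  also have "\<dots> = monom_eval x m * monom_eval x m'"
    by (simp add: monom_eval_superset[of ?K])
  finally show ?thesis .
qed

lemma poly_eval_superset:
  assumes "finite K" and "Poly_Mapping.keys P \<subseteq> K"
  shows "poly_eval x P = (\<Sum>m\<in>K. Poly_Mapping.lookup P m * monom_eval x m)"
  unfolding poly_eval_def monom_eval_def using assms
  by (intro sum.mono_neutral_left) (auto simp: in_keys_iff)

lemma poly_eval_zero: "poly_eval x 0 = 0"
  by (simp add: poly_eval_def)

lemma poly_eval_add: "poly_eval x (P + Q) = poly_eval x P + poly_eval x Q"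
proof -
  let ?K = "Poly_Mapping.keys P \<union> Poly_Mapping.keys Q"
  have "poly_eval x (P + Q) = (\<Sum>m\<in>?K. Poly_Mapping.lookup (P + Q) m * monom_eval x m)"
    by (rule poly_eval_superset) (simp_all add: keys_add)
  then show ?thesis
    by (simp add: poly_eval_superset[of ?K] lookup_add ring_distribs sum.distrib)
qed

lemma poly_eval_sum: "poly_eval x (\<Sum>i\<in>I. P i) = (\<Sum>i\<in>I. poly_eval x (P i))"
  by (induction I rule: infinite_finite_induct) (simp_all add: poly_eval_zero poly_eval_add)

lemma poly_eval_single: "poly_eval x (Poly_Mapping.single m c) = c * monom_eval x m"
  by (subst poly_eval_superset[of "{m}"]) auto

lemma sum_single_lookup:
  "(\<Sum>m\<in>Poly_Mapping.keys P. Poly_Mapping.single m (Poly_Mapping.lookup P m)) = P"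
  by (rule poly_mapping_eqI) (simp add: lookup_sum lookup_single when_def in_keys_iff)

text \<open>Expanding both factors into single monomials reduces the claim to
  \<open>monom_eval_add\<close> and avoids the convolution formula for the coefficients of
  \<open>P * Q\<close>, some of which may cancel.\<close>

lemma poly_eval_mult: "poly_eval x (P * Q) = poly_eval x P * poly_eval x Q"
proof -
  let ?s = "\<lambda>P m. Poly_Mapping.single m (Poly_Mapping.lookup P m)"
  have "P * Q = (\<Sum>m\<in>Poly_Mapping.keys P. ?s P m) * (\<Sum>m\<in>Poly_Mapping.keys Q. ?s Q m)"
    by (simp only: sum_single_lookup)
  also have "\<dots> = (\<Sum>m\<in>Poly_Mapping.keys P. \<Sum>m'\<in>Poly_Mapping.keys Q.
      Poly_Mapping.single (m + m') (Poly_Mapping.lookup P m * Poly_Mapping.lookup Q m'))"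
    by (simp add: sum_product mult_single)
  finally have "poly_eval x (P * Q) = (\<Sum>m\<in>Poly_Mapping.keys P. \<Sum>m'\<in>Poly_Mapping.keys Q.
      (Poly_Mapping.lookup P m * monom_eval x m) * (Poly_Mapping.lookup Q m' * monom_eval x m'))"
    by (simp add: poly_eval_sum poly_eval_single monom_eval_add mult_ac)
  also have "\<dots> = poly_eval x P * poly_eval x Q"
    by (simp add: sum_product poly_eval_def monom_eval_def)
  finally show ?thesis .
qed

text \<open>Working with values instead of formal polynomials lets closure properties apply directly
  to a determinant, while \<open>V\<close> records the indeterminates that
  \<open>for_generic_components\<close> admits.\<close>

definition polynomial_function :: "'v set \<Rightarrow> (('v \<Rightarrow> real) \<Rightarrow> real) \<Rightarrow> bool" where
  "polynomial_function V F \<longleftrightarrow> (\<exists>P. poly_vars P \<subseteq> V \<and> (\<forall>x. poly_eval x P = F x))"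

lemma polynomial_function_const: "polynomial_function V (\<lambda>x. c)"
  unfolding polynomial_function_def
  by (rule exI[of _ "Poly_Mapping.single 0 c"])
    (simp add: poly_vars_def poly_eval_single monom_eval_def)

lemma polynomial_function_var:
  assumes "v \<in> V"
  shows "polynomial_function V (\<lambda>x. x v)"
  unfolding polynomial_function_def
  by (rule exI[of _ "Poly_Mapping.single (Poly_Mapping.single v 1) 1"])
    (use assms in \<open>simp add: poly_vars_def poly_eval_single monom_eval_def\<close>)

lemma polynomial_function_add:
  assumes "polynomial_function V F" and "polynomial_function V G"
  shows "polynomial_function V (\<lambda>x. F x + G x)"
proof -
  obtain P Q where "poly_vars P \<subseteq> V" "poly_vars Q \<subseteq> V"
    and "\<forall>x. poly_eval x P = F x" "\<forall>x. poly_eval x Q = G x"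
    using assms unfolding polynomial_function_def by blast
  moreover have "poly_vars (P + Q) \<subseteq> poly_vars P \<union> poly_vars Q"
    using keys_add[of P Q] unfolding poly_vars_def by auto
  ultimately show ?thesis
    unfolding polynomial_function_def by (intro exI[of _ "P + Q"]) (auto simp: poly_eval_add)
qed

lemma polynomial_function_mult:
  assumes "polynomial_function V F" and "polynomial_function V G"
  shows "polynomial_function V (\<lambda>x. F x * G x)"
proof -
  obtain P Q where "poly_vars P \<subseteq> V" "poly_vars Q \<subseteq> V"
    and "\<forall>x. poly_eval x P = F x" "\<forall>x. poly_eval x Q = G x"
    using assms unfolding polynomial_function_def by blast
  moreover have "poly_vars (P * Q) \<subseteq> poly_vars P \<union> poly_vars Q"
  proof
    fix v assume "v \<in> poly_vars (P * Q)"
    then obtain m m' where "m \<in> Poly_Mapping.keys P" "m' \<in> Poly_Mapping.keys Q"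
      and "v \<in> Poly_Mapping.keys (m + m')"
      using keys_mult[of P Q] unfolding poly_vars_def by blast
    then show "v \<in> poly_vars P \<union> poly_vars Q"
      using keys_add[of m m'] unfolding poly_vars_def by blast
  qed
  ultimately show ?thesis
    unfolding polynomial_function_def by (intro exI[of _ "P * Q"]) (auto simp: poly_eval_mult)
qed

lemma polynomial_function_if:
  assumes "polynomial_function V F" and "polynomial_function V G"
  shows "polynomial_function V (\<lambda>x. if b then F x else G x)"
  using assms by (cases b) simp_all

lemma polynomial_function_sum:
  "(\<And>i. i \<in> I \<Longrightarrow> polynomial_function V (F i)) \<Longrightarrow> polynomial_function V (\<lambda>x. \<Sum>i\<in>I. F i x)"
  by (induction I rule: infinite_finite_induct)
    (simp_all add: polynomial_function_const polynomial_function_add)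

lemma polynomial_function_prod:
  "(\<And>i. i \<in> I \<Longrightarrow> polynomial_function V (F i)) \<Longrightarrow> polynomial_function V (\<lambda>x. \<Prod>i\<in>I. F i x)"
  by (induction I rule: infinite_finite_induct)
    (simp_all add: polynomial_function_const polynomial_function_mult)

text \<open>By the Leibniz expansion the determinant is a sum of signed products of entries;
  permutations keep the indices below \<open>n\<close>.\<close>

lemma polynomial_function_det:
  assumes "\<And>x. A x \<in> carrier_mat n n"
    and "\<And>i j. i < n \<Longrightarrow> j < n \<Longrightarrow> polynomial_function V (\<lambda>x. A x $$ (i, j))"
  shows "polynomial_function V (\<lambda>x. det (A x))"
  unfolding det_def'[OF assms(1)]
  by (intro polynomial_function_sum polynomial_function_mult polynomial_function_const
      polynomial_function_prod assms(2)) (use permutes_in_image in fastforce)+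

section \<open>Matrices labelled by lists of indices\<close>

definition indexed_mat :: "'a list \<Rightarrow> 'b list \<Rightarrow> ('a \<Rightarrow> 'b \<Rightarrow> real) \<Rightarrow> real mat" where
  "indexed_mat xs ys f = mat (length xs) (length ys) (\<lambda>(i, j). f (xs ! i) (ys ! j))"

lemma indexed_mat_carrier [simp]:
  "indexed_mat xs ys f \<in> carrier_mat (length xs) (length ys)"
  by (simp add: indexed_mat_def)

lemma indexed_mat_index:
  "i < length xs \<Longrightarrow> j < length ys \<Longrightarrow> indexed_mat xs ys f $$ (i, j) = f (xs ! i) (ys ! j)"
  by (simp add: indexed_mat_def)

lemma indexed_mat_cong:
  assumes "\<And>x y. x \<in> set xs \<Longrightarrow> y \<in> set ys \<Longrightarrow> f x y = g x y"
  shows "indexed_mat xs ys f = indexed_mat xs ys g"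
  using assms by (auto simp: indexed_mat_def)

lemma sum_nth_distinct:
  assumes "distinct xs"
  shows "(\<Sum>i = 0..<length xs. f (xs ! i)) = (\<Sum>x\<in>set xs. f x)"
  using assms by (intro sum.reindex_bij_betw bij_betw_nth) auto

text \<open>Distinctness turns the sum over positions into a sum over labels, so that all later
  products are computed on labels alone.\<close>

lemma indexed_mat_mult:
  assumes "distinct ys"
  shows "indexed_mat xs ys f * indexed_mat ys zs g =
    indexed_mat xs zs (\<lambda>x z. \<Sum>y\<in>set ys. f x y * g y z)"
  by (rule eq_matI)
    (simp_all add: indexed_mat_def scalar_prod_def sum_nth_distinct[OF assms, symmetric])

lemma indexed_mat_one:
  assumes "distinct xs"
  shows "indexed_mat xs xs (\<lambda>x y. if x = y then 1 else 0) = 1\<^sub>m (length xs)"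
  by (rule eq_matI) (simp_all add: indexed_mat_def nth_eq_iff_index_eq[OF assms])

lemma M_mat_indexed:
  "M_mat n2 n3 T p q = indexed_mat (index_list q p n2) (index_list q (p + 1) n3) (M_entry T q)"
  by (simp add: M_mat_def indexed_mat_def)

section \<open>The matrix K(x) of the wedge product with x, and its row relations\<close>

definition koszul :: "nat \<Rightarrow> (nat \<Rightarrow> real) \<Rightarrow> nat set \<Rightarrow> nat set \<Rightarrow> real" where
  "koszul q x S U = (\<Sum>i=1..q. if i \<notin> S \<and> U = insert i S then sigma_sign U i * x i else 0)"

text \<open>The flattening is linear in the tensor, and a rank one term yields a Kronecker
  product.\<close>

lemma M_entry_tensor_of_components:
  "M_entry (tensor_of_components r a b c) q (S, j) (U, k) =
    (\<Sum>l=1..r. koszul q (a l) S U * b l j * c l k)"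
proof -
  have "M_entry (tensor_of_components r a b c) q (S, j) (U, k) =
     (\<Sum>i=1..q. \<Sum>l=1..r. (if i \<notin> S \<and> U = insert i S then sigma_sign U i * a l i else 0) * b l j * c l k)"
    unfolding M_entry_def tensor_of_components_def outer3_def prod.case
    by (intro sum.cong refl) (simp add: sum_distrib_left mult_ac)
  also have "\<dots> = (\<Sum>l=1..r. koszul q (a l) S U * b l j * c l k)"
    unfolding koszul_def sum_distrib_right by (rule sum.swap)
  finally show ?thesis .
qed

lemma sigma_sign_square: "sigma_sign U i * sigma_sign U i = 1"
  by (simp add: sigma_sign_def power_mult_distrib[symmetric])

lemma sigma_sign_insert_self: "sigma_sign (insert i W) i = sigma_sign W i"
proof -
  have "{j \<in> insert i W. j < i} = {j \<in> W. j < i}"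
    by auto
  then show ?thesis
    by (simp add: sigma_sign_def)
qed

lemma sigma_sign_insert:
  assumes "j \<notin> W"
  shows "sigma_sign (insert j W) i = (if j < i then - sigma_sign W i else sigma_sign W i)"
proof (cases "j < i")
  case True
  then have "{k \<in> insert j W. k < i} = insert j {k \<in> W. k < i}"
    by auto
  moreover have "finite {k \<in> W. k < i}"
    by (rule finite_subset[of _ "{..<i}"]) auto
  ultimately show ?thesis
    using True assms by (simp add: sigma_sign_def)
next
  case False
  then have "{k \<in> insert j W. k < i} = {k \<in> W. k < i}"
    by auto
  with False show ?thesis
    by (simp add: sigma_sign_def)
qed

text \<open>This is \<open>x \<and> (x \<and> e\<^sub>W) = 0\<close> in the exterior algebra.\<close>

lemma koszul_relation:
  "(\<Sum>i\<in>{1..q} - W. sigma_sign W i * x i * koszul q x (insert i W) U) = 0"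
proof -
  \<comment> \<open>\<open>F i j\<close> is the contribution of inserting first \<open>i\<close>,
    then \<open>j\<close> into \<open>W\<close>. The guard \<open>j \<noteq> i\<close> makes the
    diagonal vanish, so that antisymmetry holds there too.\<close>
  define F where "F i j = (if j \<noteq> i \<and> U = insert j (insert i W)
    then sigma_sign W i * x i * (sigma_sign U j * x j) else 0)" for i j
  have anti: "F i j = - F j i" if "i \<notin> W" "j \<notin> W" for i j
  proof -
    \<comment> \<open>Exactly one of \<open>i < j\<close> and \<open>j < i\<close> holds, so exactly
      one of the two signs flips when the other element is inserted.\<close>
    have "sigma_sign W i * sigma_sign U j = - (sigma_sign W j * sigma_sign U i)"
      if "i \<noteq> j" and U: "U = insert j (insert i W)"
    proof -
      have "sigma_sign U j = sigma_sign (insert i W) j"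
        unfolding U by (rule sigma_sign_insert_self)
      moreover have "sigma_sign U i = sigma_sign (insert j W) i"
        unfolding U insert_commute[of j i] by (rule sigma_sign_insert_self)
      ultimately show ?thesis
        using \<open>i \<notin> W\<close> \<open>j \<notin> W\<close> \<open>i \<noteq> j\<close> by (simp add: sigma_sign_insert)
    qed
    then show ?thesis
      by (auto simp: F_def insert_commute algebra_simps)
  qed
  have F: "sigma_sign W i * x i * koszul q x (insert i W) U = (\<Sum>j\<in>{1..q} - W. F i j)"
    if "i \<in> {1..q} - W" for i
  proof -
    have "sigma_sign W i * x i * koszul q x (insert i W) U =
      (\<Sum>j=1..q. if j \<notin> insert i W \<and> U = insert j (insert i W)
         then sigma_sign W i * x i * (sigma_sign U j * x j) else 0)"
      unfolding koszul_def sum_distrib_left by (intro sum.cong) auto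
    also have "\<dots> = (\<Sum>j\<in>{1..q} - W. F i j)"
      by (rule sum.mono_neutral_cong_right) (auto simp: F_def)
    finally show ?thesis .
  qed
  let ?D = "\<Sum>i\<in>{1..q} - W. \<Sum>j\<in>{1..q} - W. F i j"
  have "?D = (\<Sum>i\<in>{1..q} - W. \<Sum>j\<in>{1..q} - W. - F j i)"
    by (intro sum.cong refl anti) auto
  also have "\<dots> = - (\<Sum>i\<in>{1..q} - W. \<Sum>j\<in>{1..q} - W. F j i)"
    by (simp add: sum_negf)
  also have "(\<Sum>i\<in>{1..q} - W. \<Sum>j\<in>{1..q} - W. F j i) = ?D"
    by (rule sum.swap)
  finally have "?D = 0"
    by simp
  then show ?thesis
    using F by simp
qed

text \<open>If \<iota> lies in \<open>S\<close>, the relation for \<open>W = S - {\<iota>}\<close>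
  contains the row of \<open>S\<close> with coefficient x \<iota> up to sign, and its other rows
  belong to sets avoiding \<iota>. The coefficients do not depend on \<open>U\<close>, so this is a
  relation between whole rows.\<close>

lemma koszul_row_in_span:
  assumes \<iota>: "\<iota> \<in> {1..q}" "x \<iota> \<noteq> 0" and S: "S \<subseteq> {1..q}" "card S = p"
  shows "\<exists>X. \<forall>U. koszul q x S U =
    (\<Sum>S' | S' \<subseteq> {1..q} - {\<iota>} \<and> card S' = p. X S' * koszul q x S' U)"
proof -
  define T where "T = {S'. S' \<subseteq> {1..q} - {\<iota>} \<and> card S' = p}"
  have finT: "finite T"
    by (rule finite_subset[of _ "Pow {1..q}"]) (auto simp: T_def)
  have "\<exists>X. \<forall>U. koszul q x S U = (\<Sum>S'\<in>T. X S' * koszul q x S' U)"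
  proof (cases "\<iota> \<in> S")
    case False
    then have "S \<in> T"
      using S by (auto simp: T_def)
    then have "(\<Sum>S'\<in>T. if S' = S then koszul q x S' U else 0) = koszul q x S U" for U
      using finT by simp
    moreover have "(\<Sum>S'\<in>T. (if S' = S then 1 else 0) * koszul q x S' U) =
        (\<Sum>S'\<in>T. if S' = S then koszul q x S' U else 0)" for U
      by (intro sum.cong) auto
    ultimately show ?thesis
      by (intro exI[of _ "\<lambda>S'. if S' = S then 1 else 0"]) simp
  next
    case True
    define W where "W = S - {\<iota>}"
    define d where "d i = - (sigma_sign W i * x i) / (sigma_sign W \<iota> * x \<iota>)" for i
    have SW: "insert \<iota> W = S" "\<iota> \<notin> W"
      using True by (auto simp: W_def)
    have fin: "finite S"
      using S finite_subset by blast
    have "Suc (card W) = p"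
      using card_Suc_Diff1[OF fin True] S by (simp add: W_def)
    then have inT: "insert i W \<in> T" if "i \<in> {1..q} - S" for i
      using that S SW True fin by (auto simp: T_def card_insert_if)
    have nz: "sigma_sign W \<iota> * x \<iota> \<noteq> 0"
      using \<iota> by (simp add: sigma_sign_def)
    have K: "koszul q x S U = (\<Sum>i\<in>{1..q} - S. d i * koszul q x (insert i W) U)" for U
    proof -
      have "{1..q} - W = insert \<iota> ({1..q} - S)"
        using SW \<iota> by auto
      then have "sigma_sign W \<iota> * x \<iota> * koszul q x S U
          + (\<Sum>i\<in>{1..q} - S. sigma_sign W i * x i * koszul q x (insert i W) U) = 0"
        using koszul_relation[where W = W and q = q and x = x and U = U] True SW by simp
      then have "koszul q x S U = - (\<Sum>i\<in>{1..q} - S. sigma_sign W i * x i * koszul q x (insert i W) U)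
          / (sigma_sign W \<iota> * x \<iota>)"
        using nz by (simp add: field_simps)
      then show ?thesis
        by (simp add: d_def sum_divide_distrib sum_negf)
    qed
    \<comment> \<open>At most one summand is nonzero, since \<open>i \<notin> W\<close> can be
      recovered from \<open>insert i W\<close>. The sum form allows the order of summation to be
      exchanged.\<close>
    define X where "X S' = (\<Sum>i\<in>{1..q} - S. if S' = insert i W then d i else 0)" for S'
    have "(\<Sum>S'\<in>T. X S' * koszul q x S' U) = koszul q x S U" for U
    proof -
      have "(\<Sum>S'\<in>T. X S' * koszul q x S' U) =
          (\<Sum>i\<in>{1..q} - S. \<Sum>S'\<in>T. if S' = insert i W then d i * koszul q x S' U else 0)"
        unfolding X_def sum_distrib_right by (subst sum.swap) (intro sum.cong refl, simp)
      also have "\<dots> = (\<Sum>i\<in>{1..q} - S. d i * koszul q x (insert i W) U)"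
        using inT finT by (intro sum.cong refl) (simp add: sum.delta)
      finally show ?thesis
        using K by simp
    qed
    then show ?thesis
      by metis
  qed
  then show ?thesis
    by (simp only: T_def)
qed

section \<open>The upper bound for arbitrary components\<close>

definition component_index :: "nat \<Rightarrow> nat \<Rightarrow> nat \<Rightarrow> (nat \<Rightarrow> nat) \<Rightarrow> (nat \<times> nat set) set" where
  "component_index r q p \<iota> = (SIGMA l:{1..r}. {S. S \<subseteq> {1..q} - {\<iota> l} \<and> card S = p})"

lemma finite_component_index: "finite (component_index r q p \<iota>)"
  unfolding component_index_def by (intro finite_SigmaI) simp_all

text \<open>This is the inner dimension of the factorization of the flattening, and the size of the
  minor used for the lower bound.\<close>

lemma card_component_index:
  assumes "\<And>l. l \<in> {1..r} \<Longrightarrow> \<iota> l \<in> {1..q}"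
  shows "card (component_index r q p \<iota>) = r * ((q - 1) choose p)"
proof -
  have "card {S. S \<subseteq> {1..q} - {\<iota> l} \<and> card S = p} = (q - 1) choose p" if "l \<in> {1..r}" for l
    using assms[OF that] by (subst n_subsets) simp_all
  then show ?thesis
    unfolding component_index_def by (subst card_SigmaI) simp_all
qed

text \<open>Expressing every row of K(a l) by the rows avoiding a pivot of \<open>a l\<close>
  factors the flattening through \<open>component_index\<close>.\<close>

lemma mat_rank_M_mat_le:
  assumes "1 \<le> q"
  shows "mat_rank (M_mat n2 n3 (tensor_of_components r a b c) p q) \<le> r * ((q - 1) choose p)"
proof -
  define Q where "Q x \<iota> X \<longleftrightarrow> (\<forall>S U. S \<subseteq> {1..q} \<longrightarrow> card S = p \<longrightarrow> koszul q x S U =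
    (\<Sum>S' | S' \<subseteq> {1..q} - {\<iota>} \<and> card S' = p. X S S' * koszul q x S' U))" for x \<iota> X
  have "\<exists>\<iota> X. \<iota> \<in> {1..q} \<and> Q x \<iota> X" for x
  proof (cases "\<exists>\<iota>\<in>{1..q}. x \<iota> \<noteq> 0")
    case True
    then obtain \<iota> where \<iota>: "\<iota> \<in> {1..q}" "x \<iota> \<noteq> 0"
      by blast
    have "\<forall>S. \<exists>X. S \<subseteq> {1..q} \<longrightarrow> card S = p \<longrightarrow> (\<forall>U. koszul q x S U =
        (\<Sum>S' | S' \<subseteq> {1..q} - {\<iota>} \<and> card S' = p. X S' * koszul q x S' U))"
      using koszul_row_in_span[of \<iota> q x _ p, OF \<iota>] by blast
    from choice[OF this] show ?thesis
      using \<iota> unfolding Q_def by blast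
  next
    case False
    \<comment> \<open>A vector vanishing on [q] has K(x) = 0, so any pivot will do; 1 is available
      because \<open>q\<close> is positive.\<close>
    then have "koszul q x S U = 0" for S U
      unfolding koszul_def by (intro sum.neutral) auto
    then have "Q x 1 X" for X
      by (simp add: Q_def)
    then show ?thesis
      using assms by auto
  qed
  then obtain \<iota>' X where \<iota>': "\<And>x. \<iota>' x \<in> {1..q}" and Q: "\<And>x. Q x (\<iota>' x) (X x)"
    by metis
  have X: "koszul q x S U =
      (\<Sum>S' | S' \<subseteq> {1..q} - {\<iota>' x} \<and> card S' = p. X x S S' * koszul q x S' U)"
    if "S \<subseteq> {1..q}" "card S = p" for x S U
    using Q that unfolding Q_def by blast
  define \<iota> where "\<iota> l = \<iota>' (a l)" for l
  obtain zs where zs: "set zs = component_index r q p \<iota>" "distinct zs"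
    using finite_distinct_list[OF finite_component_index] by blast
  have len: "length zs = r * ((q - 1) choose p)"
    using zs card_component_index[of r \<iota> q p] \<iota>' by (simp add: \<iota>_def distinct_card[symmetric])
  let ?L = "indexed_mat (index_list q p n2) zs (\<lambda>(S, j) (l, S'). X (a l) S S' * b l j)"
  let ?R = "indexed_mat zs (index_list q (p + 1) n3) (\<lambda>(l, S') (U, k). koszul q (a l) S' U * c l k)"
  have "M_mat n2 n3 (tensor_of_components r a b c) p q = ?L * ?R"
    unfolding M_mat_indexed indexed_mat_mult[OF zs(2)]
  proof (rule indexed_mat_cong)
    fix y z assume "y \<in> set (index_list q p n2)" "z \<in> set (index_list q (p + 1) n3)"
    then obtain S j U k where yz: "y = (S, j)" "z = (U, k)" and S: "S \<subseteq> {1..q}" "card S = p"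
      unfolding set_index_list by auto
    have "M_entry (tensor_of_components r a b c) q y z =
        (\<Sum>l=1..r. \<Sum>S' | S' \<subseteq> {1..q} - {\<iota> l} \<and> card S' = p.
          (X (a l) S S' * b l j) * (koszul q (a l) S' U * c l k))"
      unfolding yz M_entry_tensor_of_components X[OF S] sum_distrib_right \<iota>_def
      by (simp add: mult_ac)
    also have "\<dots> = (\<Sum>(l, S')\<in>set zs. (X (a l) S S' * b l j) * (koszul q (a l) S' U * c l k))"
      unfolding zs component_index_def by (intro sum.Sigma) simp_all
    finally show "M_entry (tensor_of_components r a b c) q y z =
      (\<Sum>u\<in>set zs. (case y of (S, j) \<Rightarrow> \<lambda>(l, S'). X (a l) S S' * b l j) u *
        (case u of (l, S') \<Rightarrow> \<lambda>(U, k). koszul q (a l) S' U * c l k) z)"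
      by (simp add: yz case_prod_unfold)
  qed
  then show ?thesis
    unfolding len[symmetric]
    by (simp only:) (rule mat_rank_le_inner_dim[OF indexed_mat_carrier indexed_mat_carrier])
qed

section \<open>One-sided inverses at a special point\<close>

lemma moment_curve_dual:
  fixes t :: "'a \<Rightarrow> real"
  assumes I: "finite I" "card I \<le> n" and inj: "inj_on t I" and l: "l \<in> I"
  shows "\<exists>\<beta>. \<forall>m\<in>I. (\<Sum>j=1..n. \<beta> j * t m ^ (j - 1)) = (if m = l then 1 else 0)"
proof -
  \<comment> \<open>The numerator of the Lagrange polynomial at node \<open>t l\<close>. Its
    coefficients divided by \<open>poly P (t l)\<close> give the dual vector, shifted by one as
    \<open>j\<close> starts from 1.\<close>
  define P where "P = (\<Prod>m\<in>I - {l}. [:- t m, 1:])"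
  have "degree P \<le> (\<Sum>m\<in>I - {l}. degree [:- t m, 1:])"
    using degree_prod_sum_le[of "I - {l}" "\<lambda>m. [:- t m, 1:]"] I by (simp add: P_def)
  also have "\<dots> = card I - 1"
    using I l by simp
  \<comment> \<open>Strict because \<open>l \<in> I\<close> makes \<open>card I\<close> positive, so
    the natural subtraction is not truncated.\<close>
  also have "\<dots> < n"
    using I l card_gt_0_iff[of I] by fastforce
  finally have deg: "degree P < n" .
  have eval: "poly P y = (\<Sum>j=1..n. coeff P (j - 1) * y ^ (j - 1))" for y
  proof -
    have "poly P y = (\<Sum>i<n. coeff P i * y ^ i)"
      unfolding poly_altdef using deg
      by (intro sum.mono_neutral_left) (auto simp: coeff_eq_0)
    then show ?thesis
      using sum.atLeast1_atMost_eq[of "\<lambda>j. coeff P (j - 1) * y ^ (j - 1)" n] by simp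
  qed
  have P: "poly P y = (\<Prod>m\<in>I - {l}. y - t m)" for y
    by (simp add: P_def poly_prod)
  have nz: "poly P (t l) \<noteq> 0"
    unfolding P using I inj l by (auto simp: inj_on_def)
  have "(\<Sum>j=1..n. coeff P (j - 1) / poly P (t l) * t m ^ (j - 1)) = (if m = l then 1 else 0)"
    if "m \<in> I" for m
  proof -
    have "(\<Sum>j=1..n. coeff P (j - 1) / poly P (t l) * t m ^ (j - 1)) = poly P (t m) / poly P (t l)"
      unfolding eval[of "t m"] sum_divide_distrib by simp
    moreover have "poly P (t m) = 0" if "m \<noteq> l"
      unfolding P using \<open>m \<in> I\<close> that I by (auto intro!: bexI[of _ m])
    ultimately show ?thesis
      using nz by simp
  qed
  then show ?thesis
    by (intro exI[of _ "\<lambda>j. coeff P (j - 1) / poly P (t l)"] ballI)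
qed

text \<open>Wedging with a basis vector is a signed partial permutation, which makes the flattening
  explicit at the special point.\<close>

lemma koszul_unit_vector:
  assumes "\<iota> \<in> {1..q}"
  shows "koszul q (\<lambda>i. if i = \<iota> then 1 else 0) S U =
    (if \<iota> \<notin> S \<and> U = insert \<iota> S then sigma_sign U \<iota> else 0)"
proof -
  have "koszul q (\<lambda>i. if i = \<iota> then 1 else 0) S U =
      (\<Sum>i=1..q. if i = \<iota> then (if \<iota> \<notin> S \<and> U = insert \<iota> S then sigma_sign U \<iota> else 0) else 0)"
    unfolding koszul_def by (intro sum.cong) auto
  then show ?thesis
    using assms by simp
qed

text \<open>Row (l, S) of the left factor acts on block \<open>S\<close> and isolates component
  \<open>l\<close> among those not killed there. Column (l, S) of the right factor does the same on
  block \<open>insert (\<iota> l) S\<close>, and its sign cancels the one from the wedge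
  product.\<close>

lemma flattening_unit_vectors_sandwich:
  assumes \<iota>: "\<And>l. l \<in> {1..r} \<Longrightarrow> \<iota> l \<in> {1..q}"
    and \<beta>: "\<And>S l m. S \<subseteq> {1..q} \<Longrightarrow> card S = p \<Longrightarrow> l \<in> {1..r} \<Longrightarrow> \<iota> l \<notin> S \<Longrightarrow> m \<in> {1..r} \<Longrightarrow> \<iota> m \<notin> S
      \<Longrightarrow> (\<Sum>j=1..n2. \<beta> S l j * b m j) = (if m = l then 1 else 0)"
    and \<gamma>: "\<And>U l m. U \<subseteq> {1..q} \<Longrightarrow> card U = p + 1 \<Longrightarrow> l \<in> {1..r} \<Longrightarrow> \<iota> l \<in> U \<Longrightarrow> m \<in> {1..r} \<Longrightarrow> \<iota> m \<in> U
      \<Longrightarrow> (\<Sum>k=1..n3. \<gamma> U l k * c m k) = (if m = l then 1 else 0)"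
    and zs: "set zs = component_index r q p \<iota>" "distinct zs"
  shows "indexed_mat zs (index_list q p n2) (\<lambda>(l, S) (S', j). if S' = S then \<beta> S l j else 0)
      * M_mat n2 n3 (tensor_of_components r (\<lambda>l i. if i = \<iota> l then 1 else 0) b c) p q
      * indexed_mat (index_list q (p + 1) n3) zs
          (\<lambda>(U, k) (l, S). if U = insert (\<iota> l) S then sigma_sign U (\<iota> l) * \<gamma> U l k else 0)
    = 1\<^sub>m (length zs)"
proof -
  let ?a = "\<lambda>l i. if i = \<iota> l then 1 else 0 :: real"
  let ?T = "tensor_of_components r ?a b c"
  let ?K = "\<lambda>l S U. if \<iota> l \<notin> S \<and> U = insert (\<iota> l) S then sigma_sign U (\<iota> l) else 0"
  let ?Sp = "\<lambda>p. {S. S \<subseteq> {1..q} \<and> card S = p}"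
  have fin: "finite (?Sp s)" for s
    by (rule finite_subset[of _ "Pow {1..q}"]) auto
  have left: "(\<Sum>y\<in>set (index_list q p n2). (case y of (S', j) \<Rightarrow> if S' = S then \<beta> S l j else 0) *
      M_entry ?T q y (U, k)) = ?K l S U * c l k"
    if lS: "(l, S) \<in> component_index r q p \<iota>" for l S U k
  proof -
    have l: "l \<in> {1..r}" and S: "S \<subseteq> {1..q}" "card S = p" "\<iota> l \<notin> S"
      using lS by (auto simp: component_index_def)
    have "(\<Sum>y\<in>set (index_list q p n2). (case y of (S', j) \<Rightarrow> if S' = S then \<beta> S l j else 0) *
        M_entry ?T q y (U, k)) =
      (\<Sum>S'\<in>?Sp p. \<Sum>j=1..n2. (if S' = S then \<beta> S l j else 0) * M_entry ?T q (S', j) (U, k))"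
      unfolding set_index_list sum.cartesian_product by (simp add: case_prod_unfold)
    also have "\<dots> = (\<Sum>S'\<in>?Sp p. if S' = S then \<Sum>j=1..n2. \<beta> S l j * M_entry ?T q (S, j) (U, k) else 0)"
      by (intro sum.cong refl) auto
    also have "\<dots> = (\<Sum>j=1..n2. \<beta> S l j * M_entry ?T q (S, j) (U, k))"
      using S fin by simp
    also have "\<dots> = (\<Sum>j=1..n2. \<Sum>m=1..r. ?K m S U * c m k * (\<beta> S l j * b m j))"
      unfolding M_entry_tensor_of_components sum_distrib_left
      using \<iota> by (intro sum.cong refl) (simp add: koszul_unit_vector)
    also have "\<dots> = (\<Sum>m=1..r. ?K m S U * c m k * (\<Sum>j=1..n2. \<beta> S l j * b m j))"
      unfolding sum_distrib_left by (rule sum.swap)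
    \<comment> \<open>Duality of \<beta> is available only for \<open>\<iota> m \<notin> S\<close>;
      for all other \<open>m\<close> the factor \<open>?K m S U\<close> is zero.\<close>
    also have "\<dots> = (\<Sum>m=1..r. if m = l then ?K l S U * c l k else 0)"
      using \<beta> l S by (intro sum.cong refl) auto
    also have "\<dots> = ?K l S U * c l k"
      using l by simp
    finally show ?thesis .
  qed
  have right: "(\<Sum>y\<in>set (index_list q (p + 1) n3). (case y of (U, k) \<Rightarrow> ?K l S U * c l k) *
      (case y of (U, k) \<Rightarrow> if U = insert (\<iota> l') S' then sigma_sign U (\<iota> l') * \<gamma> U l' k else 0))
      = (if (l, S) = (l', S') then 1 else 0)"
    if lS: "(l, S) \<in> component_index r q p \<iota>" "(l', S') \<in> component_index r q p \<iota>" for l S l' S'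
  proof -
    let ?U = "insert (\<iota> l') S'"
    have l: "l \<in> {1..r}" "l' \<in> {1..r}" and S: "S \<subseteq> {1..q}" "\<iota> l \<notin> S"
      and S': "S' \<subseteq> {1..q}" "card S' = p" "\<iota> l' \<notin> S'"
      using lS by (auto simp: component_index_def)
    have U: "?U \<subseteq> {1..q}" "card ?U = p + 1"
      using l S' \<iota> finite_subset[OF S'(1)] by auto
    have "(\<Sum>y\<in>set (index_list q (p + 1) n3). (case y of (U, k) \<Rightarrow> ?K l S U * c l k) *
      (case y of (U, k) \<Rightarrow> if U = ?U then sigma_sign U (\<iota> l') * \<gamma> U l' k else 0)) =
      (\<Sum>U\<in>?Sp (p + 1). \<Sum>k=1..n3. (?K l S U * c l k) *
        (if U = ?U then sigma_sign U (\<iota> l') * \<gamma> U l' k else 0))"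
      unfolding set_index_list sum.cartesian_product by (simp add: case_prod_unfold)
    also have "\<dots> = (\<Sum>U\<in>?Sp (p + 1). if U = ?U then
        \<Sum>k=1..n3. (?K l S ?U * c l k) * (sigma_sign ?U (\<iota> l') * \<gamma> ?U l' k) else 0)"
      by (intro sum.cong refl) auto
    also have "\<dots> = (\<Sum>k=1..n3. (?K l S ?U * c l k) * (sigma_sign ?U (\<iota> l') * \<gamma> ?U l' k))"
      using U fin by simp
    also have "\<dots> = ?K l S ?U * sigma_sign ?U (\<iota> l') * (\<Sum>k=1..n3. \<gamma> ?U l' k * c l k)"
      unfolding sum_distrib_left by (intro sum.cong refl) (simp add: mult_ac)
    \<comment> \<open>If \<open>?U = insert (\<iota> l) S\<close>, then \<open>?U\<close> contains
      both \<iota> l and \<iota> l', so \<gamma> separates \<open>l\<close> from \<open>l'\<close>,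
      and equal components force equal sets. Otherwise \<open>?K\<close> vanishes and the pairs
      differ.\<close>
    also have "\<dots> = (if (l, S) = (l', S') then 1 else 0)"
    proof (cases "?U = insert (\<iota> l) S")
      case True
      then have sum: "(\<Sum>k=1..n3. \<gamma> ?U l' k * c l k) = (if l = l' then 1 else 0)"
        using \<gamma>[OF U] l by blast
      show ?thesis
      proof (cases "l = l'")
        case l_eq: True
        then have "S = S'"
          using True S S' by (metis insert_ident)
        with l_eq sum S show ?thesis
          by (simp add: sigma_sign_square)
      next
        case False
        with sum show ?thesis
          by simp
      qed
    next
      case False
      then show ?thesis
        by auto
    qed
    finally show ?thesis .
  qed
  have "indexed_mat zs (index_list q p n2) (\<lambda>(l, S) (S', j). if S' = S then \<beta> S l j else 0)
      * M_mat n2 n3 ?T p q =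
      indexed_mat zs (index_list q (p + 1) n3) (\<lambda>(l, S) (U, k). ?K l S U * c l k)"
    unfolding M_mat_indexed indexed_mat_mult[OF distinct_index_list]
  proof (rule indexed_mat_cong)
    fix x and z :: "nat set \<times> nat" assume x: "x \<in> set zs"
    obtain l S U k where xz: "x = (l, S)" "z = (U, k)"
      by (cases x, cases z)
    show "(\<Sum>y\<in>set (index_list q p n2).
        (case x of (l, S) \<Rightarrow> \<lambda>(S', j). if S' = S then \<beta> S l j else 0) y * M_entry ?T q y z) =
      (case x of (l, S) \<Rightarrow> \<lambda>(U, k). ?K l S U * c l k) z"
      using left[of l S U k] x zs unfolding xz prod.case by simp
  qed
  moreover have "indexed_mat zs (index_list q (p + 1) n3) (\<lambda>(l, S) (U, k). ?K l S U * c l k) *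
      indexed_mat (index_list q (p + 1) n3) zs
        (\<lambda>(U, k) (l, S). if U = insert (\<iota> l) S then sigma_sign U (\<iota> l) * \<gamma> U l k else 0) =
      indexed_mat zs zs (\<lambda>x y. if x = y then 1 else 0)"
    unfolding indexed_mat_mult[OF distinct_index_list]
  proof (rule indexed_mat_cong)
    fix x z assume x: "x \<in> set zs" "z \<in> set zs"
    obtain l S l' S' where xz: "x = (l, S)" "z = (l', S')"
      by (cases x, cases z)
    have eq: "(case y of (U, k) \<Rightarrow> \<lambda>(l, S). if U = insert (\<iota> l) S then sigma_sign U (\<iota> l) * \<gamma> U l k else 0) (l', S')
      = (case y of (U, k) \<Rightarrow> if U = insert (\<iota> l') S' then sigma_sign U (\<iota> l') * \<gamma> U l' k else 0)" for y
      by (simp add: case_prod_unfold)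
    show "(\<Sum>y\<in>set (index_list q (p + 1) n3).
        (case x of (l, S) \<Rightarrow> \<lambda>(U, k). ?K l S U * c l k) y *
        (case y of (U, k) \<Rightarrow> \<lambda>(l, S). if U = insert (\<iota> l) S
          then sigma_sign U (\<iota> l) * \<gamma> U l k else 0) z) = (if x = z then 1 else 0)"
      using right[of l S l' S'] x zs unfolding xz eq prod.case by simp
  qed
  ultimately show ?thesis
    by (simp add: indexed_mat_one[OF zs(2)])
qed

section \<open>The cyclic choice of basis vectors and the generic rank\<close>

lemma card_residue_class_le:
  assumes "q > 0"
  shows "card {l \<in> {1..r}. l mod q = s} \<le> r div q + 1"
proof -
  \<comment> \<open>Members of one residue class are told apart by their quotients, which lie
    between 0 and \<open>r div q\<close>.\<close>
  have "inj_on (\<lambda>l. l div q) {l \<in> {1..r}. l mod q = s}"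
    by (rule inj_onI) (metis (mono_tags, lifting) div_mult_mod_eq mem_Collect_eq)
  moreover have "(\<lambda>l. l div q) ` {l \<in> {1..r}. l mod q = s} \<subseteq> {0..r div q}"
    by (auto simp: div_le_mono)
  ultimately have "card {l \<in> {1..r}. l mod q = s} \<le> card {0..r div q}"
    by (intro card_inj_on_le) auto
  then show ?thesis
    by simp
qed

lemma card_residue_classes_le:
  assumes "q > 0" and "finite J"
  shows "card {l \<in> {1..r}. Suc (l mod q) \<in> J} \<le> card J * (r div q + 1)"
proof -
  have "{l \<in> {1..r}. Suc (l mod q) \<in> J} = (\<Union>i\<in>J. {l \<in> {1..r}. Suc (l mod q) = i})"
    by auto
  then have "card {l \<in> {1..r}. Suc (l mod q) \<in> J} \<le> (\<Sum>i\<in>J. card {l \<in> {1..r}. Suc (l mod q) = i})"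
    by (simp only: card_UN_le[OF assms(2)])
  also have "\<dots> \<le> (\<Sum>i\<in>J. r div q + 1)"
  proof (rule sum_mono)
    fix i
    \<comment> \<open>For \<open>i = 0\<close> the left set is empty, so the truncated
      \<open>i - 1\<close> does no harm.\<close>
    have "card {l \<in> {1..r}. Suc (l mod q) = i} \<le> card {l \<in> {1..r}. l mod q = i - 1}"
      by (intro card_mono) auto
    then show "card {l \<in> {1..r}. Suc (l mod q) = i} \<le> r div q + 1"
      using card_residue_class_le[OF assms(1), of r "i - 1"] by simp
  qed
  finally show ?thesis
    by simp
qed

text \<open>Each basis vector is used at most \<open>r div q + 1\<close> times. A row set misses
  \<open>q - p\<close> of them and a column set contains \<open>p + 1\<close>, so the two
  inequalities are what interpolation in dimensions \<open>n2\<close> and \<open>n3\<close>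
  requires.\<close>

lemma generic_rank_of_balanced:
  assumes q: "1 \<le> q" "q \<le> n1"
    and n2: "(q - p) * (r div q + 1) \<le> n2" and n3: "(p + 1) * (r div q + 1) \<le> n3"
  shows "for_generic_components n1 n2 n3 r
    (\<lambda>a b c. mat_rank (M_mat n2 n3 (tensor_of_components r a b c) p q) = r * ((q - 1) choose p))"
proof -
  define \<iota> where "\<iota> l = Suc (l mod q)" for l
  have \<iota>: "\<iota> l \<in> {1..q}" for l
    using q by (simp add: \<iota>_def Suc_le_eq)
  \<comment> \<open>Component \<open>m\<close> gets the node \<open>m\<close> on the moment
    curve.\<close>
  have inj: "inj_on real I" for I
    by (simp add: inj_on_def)
  define dual where "dual n I l \<beta> \<longleftrightarrow>
    (\<forall>m\<in>I. (\<Sum>j=1..n. \<beta> j * real m ^ (j - 1)) = (if m = l then 1 else 0))"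
    for n l :: nat and I \<beta>
  have "\<exists>\<beta>. dual n2 {m \<in> {1..r}. \<iota> m \<notin> S} l \<beta>"
    if S: "S \<subseteq> {1..q}" "card S = p" and l: "l \<in> {1..r}" "\<iota> l \<notin> S" for S l
  proof -
    let ?I = "{m \<in> {1..r}. \<iota> m \<in> {1..q} - S}"
    have "card ({1..q} - S) = q - p"
      using S by (simp add: card_Diff_subset finite_subset[OF S(1)])
    then have "card ?I \<le> n2"
      using card_residue_classes_le[of q "{1..q} - S" r] q n2 by (simp add: \<iota>_def)
    moreover have "?I = {m \<in> {1..r}. \<iota> m \<notin> S}"
      using \<iota> by auto
    ultimately show ?thesis
      using moment_curve_dual[OF _ _ inj, of "{m \<in> {1..r}. \<iota> m \<notin> S}" n2 l] l
      unfolding dual_def by simp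
  qed
  then obtain \<beta> where \<beta>: "\<And>S l. S \<subseteq> {1..q} \<Longrightarrow> card S = p \<Longrightarrow> l \<in> {1..r} \<Longrightarrow> \<iota> l \<notin> S
      \<Longrightarrow> dual n2 {m \<in> {1..r}. \<iota> m \<notin> S} l (\<beta> S l)"
    by metis
  have "\<exists>\<gamma>. dual n3 {m \<in> {1..r}. \<iota> m \<in> U} l \<gamma>"
    if U: "U \<subseteq> {1..q}" "card U = p + 1" and l: "l \<in> {1..r}" "\<iota> l \<in> U" for U l
  proof -
    have "card {m \<in> {1..r}. \<iota> m \<in> U} \<le> n3"
      using card_residue_classes_le[of q U r] q n3 U finite_subset[OF U(1)] by (simp add: \<iota>_def)
    then show ?thesis
      using moment_curve_dual[OF _ _ inj, of "{m \<in> {1..r}. \<iota> m \<in> U}" n3 l] l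
      unfolding dual_def by simp
  qed
  then obtain \<gamma> where \<gamma>: "\<And>U l. U \<subseteq> {1..q} \<Longrightarrow> card U = p + 1 \<Longrightarrow> l \<in> {1..r} \<Longrightarrow> \<iota> l \<in> U
      \<Longrightarrow> dual n3 {m \<in> {1..r}. \<iota> m \<in> U} l (\<gamma> U l)"
    by metis
  obtain zs where zs: "set zs = component_index r q p \<iota>" "distinct zs"
    using finite_distinct_list[OF finite_component_index] by blast
  have len: "length zs = r * ((q - 1) choose p)"
    using zs card_component_index[of r \<iota> q p] \<iota> by (simp add: distinct_card[symmetric])
  let ?M = "\<lambda>a b c. M_mat n2 n3 (tensor_of_components r a b c) p q"
  define l where "l = (\<lambda>(l, S) (S', j). if S' = S then \<beta> S l j else 0)"
  define g where "g = (\<lambda>(U, k) (l, S). if U = insert (\<iota> l) S then sigma_sign U (\<iota> l) * \<gamma> U l k else 0)"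
  define L where "L = indexed_mat zs (index_list q p n2) l"
  define R where "R = indexed_mat (index_list q (p + 1) n3) zs g"
  \<comment> \<open>\<open>L\<close> and \<open>R\<close> are constants fixed by the special point;
    only the flattening varies with \<open>x\<close>.\<close>
  define D where "D x = det (L * ?M (\<lambda>l i. x (ACoord l i)) (\<lambda>l j. x (BCoord l j)) (\<lambda>l k. x (CCoord l k)) * R)" for x
  have D: "D (coord_val a b c) = det (L * ?M a b c * R)" for a b c
    by (simp add: D_def)
  have poly: "polynomial_function (coords n1 n2 n3 r) D"
    unfolding D_def
  proof (rule polynomial_function_det)
    fix x
    let ?M' = "?M (\<lambda>l i. x (ACoord l i)) (\<lambda>l j. x (BCoord l j)) (\<lambda>l k. x (CCoord l k))"
    show "L * ?M' * R \<in> carrier_mat (length zs) (length zs)"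
      unfolding L_def R_def M_mat_indexed by (intro mult_carrier_mat) (rule indexed_mat_carrier)+
  next
    fix u v assume uv: "u < length zs" "v < length zs"
    have var: "polynomial_function (coords n1 n2 n3 r)
        (\<lambda>x. M_entry (tensor_of_components r (\<lambda>l i. x (ACoord l i)) (\<lambda>l j. x (BCoord l j))
          (\<lambda>l k. x (CCoord l k))) q y z)"
      if y: "y \<in> set (index_list q p n2)" and z: "z \<in> set (index_list q (p + 1) n3)" for y z
    proof -
      obtain S j U k where yz: "y = (S, j)" "z = (U, k)" and "j \<in> {1..n2}" "k \<in> {1..n3}"
        using y z unfolding set_index_list by auto
      \<comment> \<open>Only coordinates \<open>i \<le> q\<close> of the first vectors occur, and
        \<open>q \<le> n1\<close> places them in \<open>coords\<close>.\<close>
      have "polynomial_function (coords n1 n2 n3 r)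
          (\<lambda>x. if i \<notin> S \<and> U = insert i S then sigma_sign U i * x (ACoord l i) else 0)"
        if "i \<in> {1..q}" "l \<in> {1..r}" for i l
        using that q
        by (intro polynomial_function_if polynomial_function_mult polynomial_function_const
            polynomial_function_var) (auto simp: coords_def)
      then show ?thesis
        unfolding yz M_entry_tensor_of_components koszul_def
        using \<open>j \<in> {1..n2}\<close> \<open>k \<in> {1..n3}\<close>
        by (intro polynomial_function_sum polynomial_function_mult polynomial_function_var)
          (auto simp: coords_def)
    qed
    show "polynomial_function (coords n1 n2 n3 r) (\<lambda>x. (L * ?M (\<lambda>l i. x (ACoord l i))
        (\<lambda>l j. x (BCoord l j)) (\<lambda>l k. x (CCoord l k)) * R) $$ (u, v))"
      unfolding L_def R_def M_mat_indexed indexed_mat_mult[OF distinct_index_list]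
        indexed_mat_index[OF uv]
      by (intro polynomial_function_sum polynomial_function_mult polynomial_function_const var)
  qed
  then obtain P where P: "poly_vars P \<subseteq> coords n1 n2 n3 r" "\<And>x. poly_eval x P = D x"
    unfolding polynomial_function_def by blast
  have "L * ?M (\<lambda>l i. if i = \<iota> l then 1 else 0) (\<lambda>m j. real m ^ (j - 1)) (\<lambda>m k. real m ^ (k - 1)) * R
      = 1\<^sub>m (length zs)"
    unfolding L_def R_def l_def g_def
  proof (rule flattening_unit_vectors_sandwich[OF \<iota> _ _ zs])
    show "(\<Sum>j=1..n2. \<beta> S l j * real m ^ (j - 1)) = (if m = l then 1 else 0)"
      if "S \<subseteq> {1..q}" "card S = p" "l \<in> {1..r}" "\<iota> l \<notin> S" "m \<in> {1..r}" "\<iota> m \<notin> S" for S l m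
      using \<beta> that unfolding dual_def by blast
    show "(\<Sum>k=1..n3. \<gamma> U l k * real m ^ (k - 1)) = (if m = l then 1 else 0)"
      if "U \<subseteq> {1..q}" "card U = p + 1" "l \<in> {1..r}" "\<iota> l \<in> U" "m \<in> {1..r}" "\<iota> m \<in> U" for U l m
      using \<gamma> that unfolding dual_def by blast
  qed
  then have "D (coord_val (\<lambda>l i. if i = \<iota> l then 1 else 0) (\<lambda>m j. real m ^ (j - 1))
      (\<lambda>m k. real m ^ (k - 1))) \<noteq> 0"
    unfolding D by simp
  moreover have "mat_rank (?M a b c) = r * ((q - 1) choose p)" if "D (coord_val a b c) \<noteq> 0" for a b c
  proof (rule antisym)
    show "mat_rank (?M a b c) \<le> r * ((q - 1) choose p)"
      by (rule mat_rank_M_mat_le[OF q(1)])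
    show "r * ((q - 1) choose p) \<le> mat_rank (?M a b c)"
      unfolding len[symmetric]
    proof (rule mat_rank_ge_of_det_nonzero)
      show "L \<in> carrier_mat (length zs) (length (index_list q p n2))"
        and "R \<in> carrier_mat (length (index_list q (p + 1) n3)) (length zs)"
        unfolding L_def R_def by (rule indexed_mat_carrier)+
      show "?M a b c \<in> carrier_mat (length (index_list q p n2)) (length (index_list q (p + 1) n3))"
        unfolding M_mat_indexed by (rule indexed_mat_carrier)
      show "det (L * ?M a b c * R) \<noteq> 0"
        using that by (simp only: D not_False_eq_True)
    qed
  qed
  ultimately show ?thesis
    unfolding for_generic_components_def using P by metis
qed

section \<open>From the bound on r to the balance inequalities\<close>

lemma balance_bound:
  fixes d r N q \<alpha> n :: real
  assumes "q > 0" "N > 0" "r \<ge> 0" "n > 0" and d: "d \<le> q * n / N + 1"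
    and r: "r \<le> N * (1 - (1 + \<alpha>) / q) - q" and \<alpha>: "n * (1 + \<alpha>) \<ge> N"
  shows "d * (r / q + 1) \<le> n"
proof -
  \<comment> \<open>In the application \<open>n\<close> is \<open>n2\<close> or \<open>n3\<close>,
    \<open>N\<close> is their sum and \<open>d\<close> is \<open>q - p\<close> or
    \<open>p + 1\<close>. The bound on \<open>r\<close> becomes r / q + 1 \<le> (N / q) (1 -
    \<epsilon>), and the loss \<epsilon> compensates for the rounding term 1 in the bound on
    \<open>d\<close>.\<close>
  define \<epsilon> where "\<epsilon> = (1 + \<alpha>) / q"
  have \<epsilon>: "N / q \<le> n * \<epsilon>"
    using \<alpha> \<open>q > 0\<close> by (simp add: \<epsilon>_def divide_right_mono)
  \<comment> \<open>The sign follows from the preceding inequality, as \<open>N / q\<close> and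
    \<open>n\<close> are positive.\<close>
  have \<epsilon>0: "\<epsilon> \<ge> 0"
    using \<epsilon> assms by (metis divide_pos_pos less_eq_real_def less_le_trans zero_less_mult_pos)
  have "(r + q) / q \<le> N * (1 - \<epsilon>) / q"
    using r \<open>q > 0\<close> by (intro divide_right_mono) (simp_all add: \<epsilon>_def)
  then have r': "r / q + 1 \<le> N / q * (1 - \<epsilon>)"
    using \<open>q > 0\<close> by (simp add: add_divide_distrib)
  have "d * (r / q + 1) \<le> (q * n / N + 1) * (r / q + 1)"
    using d assms by (intro mult_right_mono) simp_all
  also have "\<dots> \<le> (q * n / N + 1) * (N / q * (1 - \<epsilon>))"
    using r' assms by (intro mult_left_mono) simp_all
  also have "\<dots> = (n + N / q) * (1 - \<epsilon>)"
    using assms by (simp add: field_simps)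
  also have "\<dots> = n + (N / q - n * \<epsilon>) - N / q * \<epsilon>"
    by (simp add: algebra_simps diff_divide_distrib)
  also have "\<dots> \<le> n"
    using \<epsilon> \<epsilon>0 assms by (smt (verit) divide_nonneg_pos mult_nonneg_nonneg)
  finally show ?thesis .
qed

theorem theorem2p4:
  fixes n1 n2 n3 p q r :: nat and \<alpha> :: real
  assumes "n1 > 0" and "n2 > 0" and "n3 > 0"
    and "1 \<le> q" and "q \<le> n1"
    and "p = nat \<lfloor>real q * (real n3 / (real n2 + real n3))\<rfloor>"
    and "\<alpha> = max (real n2 / real n3) (real n3 / real n2)"
    and "real r \<le> (real n2 + real n3) * (1 - (1 + \<alpha>) / real q) - real q"
  shows "for_generic_components n1 n2 n3 r
           (\<lambda>a b c. mat_rank (M_mat n2 n3 (tensor_of_components r a b c) p q)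
                    = r * ((q - 1) choose p))"
proof (rule generic_rank_of_balanced)
  define N where "N = real n2 + real n3"
  define k where "k = r div q + 1"
  have pos: "real q > 0" "N > 0" "real n2 > 0" "real n3 > 0"
    using assms(2-4) by (simp_all add: N_def)
  have r: "real r \<le> N * (1 - (1 + \<alpha>) / real q) - real q"
    using assms(8) by (simp add: N_def)
  have k: "real k \<le> real r / real q + 1"
    by (simp add: k_def of_nat_div_le_of_nat)
  have "real p = of_int \<lfloor>real q * real n3 / N\<rfloor>"
    using assms(6) pos by (simp add: N_def)
  then have p: "real p \<le> real q * real n3 / N" "real q * real n3 / N < real p + 1"
    by linarith+
  have sum: "real q * real n2 / N + real q * real n3 / N = real q"
    using pos by (simp add: add_divide_distrib[symmetric] distrib_left[symmetric] N_def[symmetric])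
  \<comment> \<open>Each of the two ratios in the maximum serves one side; both right-hand sides
    equal \<open>N\<close>.\<close>
  have "real n2 * (1 + \<alpha>) \<ge> real n2 * (1 + real n3 / real n2)"
    and "real n3 * (1 + \<alpha>) \<ge> real n3 * (1 + real n2 / real n3)"
    unfolding assms(7) by (intro mult_left_mono; simp)+
  then have \<alpha>: "real n2 * (1 + \<alpha>) \<ge> N" "real n3 * (1 + \<alpha>) \<ge> N"
    using pos by (simp_all add: N_def field_simps)
  have "real q * real n2 / N \<ge> 0"
    using pos by simp
  then have "p \<le> q"
    using p(1) sum by linarith
  \<comment> \<open>The two shares of \<open>q\<close> add up to \<open>q\<close>, so rounding the
    \<open>n3\<close> share down enlarges the complementary share by less than 1.\<close>
  have d2: "real (q - p) \<le> real q * real n2 / N + 1"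
    using p sum \<open>p \<le> q\<close> by (simp add: of_nat_diff)
  have "real (q - p) * real k \<le> real (q - p) * (real r / real q + 1)"
    using k by (intro mult_left_mono) simp_all
  also have "\<dots> \<le> real n2"
    using balance_bound[OF pos(1,2) _ pos(3) d2 r \<alpha>(1)] by simp
  finally show "(q - p) * (r div q + 1) \<le> n2"
    unfolding k_def of_nat_mult[symmetric] of_nat_le_iff .
  have d3: "real (p + 1) \<le> real q * real n3 / N + 1"
    using p by simp
  have "real (p + 1) * real k \<le> real (p + 1) * (real r / real q + 1)"
    using k by (intro mult_left_mono) simp_all
  also have "\<dots> \<le> real n3"
    using balance_bound[OF pos(1,2) _ pos(4) d3 r \<alpha>(2)] by simp
  finally show "(p + 1) * (r div q + 1) \<le> n3"
    unfolding k_def of_nat_mult[symmetric] of_nat_le_iff .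
qed (fact assms)+

end
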